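(* Let $\mathcal{S}_t\subseteq\{1,\dots,K\}$ be a nonempty finite set of selected clients, $d\ge 1$ an integer, and let $\mathsf{P}_0>0$, $\sigma^2>0$, $v_t>0$. For each $k\in\mathcal{S}_t$ let $h_{t,k}\in\mathbb{C}\setminus\{0\}$ be a channel coefficient and $\lambda^{\star}_{t,k}>0$ a weight. For local gradients $\mathbf{g}_{t,k}\in\mathbb{R}^d$ ($k\in\mathcal{S}_t$) put $$\mathbf{g}_t=\sum_{k\in\mathcal{S}_t}\lambda^{\star}_{t,k}\,\mathbf{g}_{t,k},$$ and for transmit scalars $b_{t,k}\in\mathbb{C}$ ($k\in\mathcal{S}_t$) and a de-noising receive scalar $c_t>0$ put $$\hat{\mathbf{g}}_t=\sum_{k\in\mathcal{S}_t}\frac{h_{t,k}b_{t,k}}{c_t}\,\mathbf{g}_{t,k}+\frac{\sqrt{v_t}}{c_t}\,\mathbf{n}_t,\qquad \mathbf{n}_t\sim\mathcal{CN}(\mathbf{0},\sigma^2\mathbf{I}_d).$$ Consider all choices of $(\{b_{t,k}\}_{k\in\mathcal{S}_t},c_t)$ that satisfy the power constraint $|b_{t,k}|^2\le\mathsf{P}_0$ for every $k\in\mathcal{S}_t$ and for which $\hat{\mathbf{g}}_t$ is an unbiased estimator of $\mathbf{g}_t$, i.e. $\mathbb{E}[\hat{\mathbf{g}}_t]=\mathbf{g}_t$ (for all values of the local gradients). Among these choices, the ones that minimize the estimation variance $\mathcal{E}(\hat{\mathbf{g}}_t,\mathbf{g}_t)=\mathbb{E}\big[\|\hat{\mathbf{g}}_t-\mathbf{g}_t\|_2^2\big]$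 are given by $$b_{t,k}=\frac{\lambda^{\star}_{t,k}\,c_t}{h_{t,k}}\quad(k\in\mathcal{S}_t),\qquad c_t=\min_{k\in\mathcal{S}_t}\frac{\sqrt{\mathsf{P}_0}\,|h_{t,k}|}{\lambda^{\star}_{t,k}},$$ and for these optimal choices the estimation variance equals $$\mathcal{E}^{\star}=\frac{d\,v_t\,\sigma^2}{\mathsf{P}_0}\,\max_{k\in\mathcal{S}_t}\frac{(\lambda^{\star}_{t,k})^2}{|h_{t,k}|^2}.$$
   Context: Setting: over-the-air gradient aggregation in federated learning at a fixed iteration $t$. Each selected client $k\in\mathcal{S}_t$ holds a local gradient $\mathbf{g}_{t,k}$, normalizes it to a unit-power symbol vector $\mathbf{s}_{t,k}$ (so that $\mathbb{E}|b_{t,k}\mathbf{s}_{t,k}[i]|^2=|b_{t,k}|^2$ for each entry $i$), and transmits $b_{t,k}\mathbf{s}_{t,k}$ over a fading Gaussian multiple-access channel. The server receives the superposition $\sum_{k\in\mathcal{S}_t}h_{t,k}b_{t,k}\mathbf{s}_{t,k}+\mathbf{n}_t$ and, after scaling by $1/c_t$ and undoing the normalization, obtains the estimator $\hat{\mathbf{g}}_t$ in the claim. The scalar $v_t$ is the weighted average variance of the local gradients used in the normalization and is treated as a given positive constant; the coefficients $h_{t,k}$ and the weights $\lambda^{\star}_{t,k}$ are also given and known. $\mathbf{n}_t\sim\mathcal{CN}(\mathbf{0},\sigma^2\mathbf{I}_d)$ denotes a zero-mean white circularly symmetric complex Gaussian vector in $\mathbb{C}^d$, so its entries are independent with mean $0$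 and $\mathbb{E}|\mathbf{n}_t[i]|^2=\sigma^2$. Expectations are over $\mathbf{n}_t$, with the gradients, channel coefficients and weights fixed. Unbiasedness is required of the design parameters irrespective of the local gradients: for fixed $(\{b_{t,k}\},c_t)$ and fixed $v_t$, $\mathbb{E}[\hat{\mathbf{g}}_t]=\mathbf{g}_t$ holds for every $(\mathbf{g}_{t,k})_{k\in\mathcal{S}_t}\in(\mathbb{R}^d)^{\mathcal{S}_t}$. $\|\cdot\|_2$ is the Euclidean norm on $\mathbb{C}^d$. *)

theory Defs
  imports "HOL-Probability.Probability"
begin

text \<open>
  The law \<open>CN(0, var I)\<close> of a white circularly symmetric complex Gaussian vector:
  the real and imaginary parts of all entries are mutually independent, each real Gaussian with
  mean \<open>0\<close> and variance \<open>var / 2\<close>, so that every entry has second absolute moment \<open>var\<close>.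
\<close>

definition white_complex_gaussian ::
  "'w measure \<Rightarrow> real \<Rightarrow> ('w \<Rightarrow> complex ^ 'd) \<Rightarrow> bool" where
  "white_complex_gaussian M var n \<longleftrightarrow>
     prob_space.indep_vars M (\<lambda>_. borel) (\<lambda>(i, part) \<omega>. part (n \<omega> $ i))
       ((UNIV :: 'd set) \<times> {Re, Im}) \<and>
     (\<forall>i. \<forall>part\<in>{Re, Im}.
        distributed M lborel (\<lambda>\<omega>. part (n \<omega> $ i)) (normal_density 0 (sqrt (var / 2))))"

definition complex_vec :: "real ^ 'd \<Rightarrow> complex ^ 'd" where
  "complex_vec x = (\<chi> i. complex_of_real (x $ i))"

definition global_gradient ::
  "nat set \<Rightarrow> (nat \<Rightarrow> real) \<Rightarrow> (nat \<Rightarrow> real ^ 'd) \<Rightarrow> real ^ 'd" where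
  "global_gradient S lam g = (\<Sum>k\<in>S. lam k *\<^sub>R g k)"

text \<open>The last argument \<open>z\<close> is the realisation of the noise vector.\<close>

definition gradient_estimator ::
  "nat set \<Rightarrow> (nat \<Rightarrow> complex) \<Rightarrow> real \<Rightarrow> (nat \<Rightarrow> complex) \<Rightarrow> real \<Rightarrow>
   (nat \<Rightarrow> real ^ 'd) \<Rightarrow> complex ^ 'd \<Rightarrow> complex ^ 'd" where
  "gradient_estimator S h v b c g z =
     (\<Sum>k\<in>S. (h k * b k / complex_of_real c) *s complex_vec (g k)) + (sqrt v / c) *\<^sub>R z"

text \<open>
  Unbiasedness is a property of the design parameters \<open>b\<close>, \<open>c\<close>: it is required for all local
  gradients. Integrability is included because the Bochner integral of a non-integrable function
  is \<open>0\<close>.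
\<close>

definition unbiased_design ::
  "'w measure \<Rightarrow> ('w \<Rightarrow> complex ^ 'd) \<Rightarrow> nat set \<Rightarrow> (nat \<Rightarrow> complex) \<Rightarrow> (nat \<Rightarrow> real) \<Rightarrow>
   real \<Rightarrow> (nat \<Rightarrow> complex) \<Rightarrow> real \<Rightarrow> bool" where
  "unbiased_design M n S h lam v b c \<longleftrightarrow>
     (\<forall>g :: nat \<Rightarrow> real ^ 'd.
        integrable M (\<lambda>\<omega>. gradient_estimator S h v b c g (n \<omega>)) \<and>
        (LINT \<omega>|M. gradient_estimator S h v b c g (n \<omega>)) = complex_vec (global_gradient S lam g))"

definition feasible_design ::
  "'w measure \<Rightarrow> ('w \<Rightarrow> complex ^ 'd) \<Rightarrow> nat set \<Rightarrow> (nat \<Rightarrow> complex) \<Rightarrow> (nat \<Rightarrow> real) \<Rightarrow>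
   real \<Rightarrow> real \<Rightarrow> (nat \<Rightarrow> complex) \<Rightarrow> real \<Rightarrow> bool" where
  "feasible_design M n S h lam v P0 b c \<longleftrightarrow>
     c > 0 \<and> (\<forall>k\<in>S. (cmod (b k))\<^sup>2 \<le> P0) \<and> unbiased_design M n S h lam v b c"

definition estimation_variance ::
  "'w measure \<Rightarrow> ('w \<Rightarrow> complex ^ 'd) \<Rightarrow> nat set \<Rightarrow> (nat \<Rightarrow> complex) \<Rightarrow> (nat \<Rightarrow> real) \<Rightarrow>
   real \<Rightarrow> (nat \<Rightarrow> real ^ 'd) \<Rightarrow> (nat \<Rightarrow> complex) \<Rightarrow> real \<Rightarrow> real" where
  "estimation_variance M n S h lam v g b c =
     (LINT \<omega>|M. (norm (gradient_estimator S h v b c g (n \<omega>)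
                        - complex_vec (global_gradient S lam g)))\<^sup>2)"

end

theory Submission
  imports Defs
begin

text \<open>
  The noise has mean zero, so unbiasedness for all local gradients forces \<open>h k * b k / c = lam k\<close>.
  The error is then the pure noise \<open>(sqrt v / c) n\<close>, whose variance \<open>d v \<sigma>\<^sup>2 / c\<^sup>2\<close> is strictly
  decreasing in \<open>c\<close>, while the power constraints become upper bounds on \<open>c\<close>. Hence the optimum is
  the largest admissible \<open>c\<close>.
\<close>

text \<open>Both moments are read off the Gaussian density of one real coordinate.
  \<open>has_bochner_integral\<close> keeps integrability and value together, so that they can be
  summed over coordinates later.\<close>

lemma white_complex_gaussian_part:
  fixes n :: "'w \<Rightarrow> complex ^ 'd"
  assumes "prob_space M" and "white_complex_gaussian M var n" and "var > 0"
    and p: "p \<in> {Re, Im}"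
  shows "has_bochner_integral M (\<lambda>\<omega>. p (n \<omega> $ i)) 0"
    and "has_bochner_integral M (\<lambda>\<omega>. (p (n \<omega> $ i))\<^sup>2) (var / 2)"
proof -
  interpret prob_space M by fact
  let ?s = "sqrt (var / 2)"
  have s: "0 < ?s" using \<open>var > 0\<close> by simp
  have D: "distributed M lborel (\<lambda>\<omega>. p (n \<omega> $ i)) (normal_density 0 ?s)"
    using assms(2) p unfolding white_complex_gaussian_def by blast
  have E: "expectation (\<lambda>\<omega>. p (n \<omega> $ i)) = 0"
    by (rule normal_distributed_expectation[OF s D])
  have I: "integrable M (\<lambda>\<omega>. (p (n \<omega> $ i)) ^ k)" for k
    using distributed_integrable[OF D, of "\<lambda>x. x ^ k"] integrable_normal_moment[OF s, of 0 k]
    by simp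
  show "has_bochner_integral M (\<lambda>\<omega>. p (n \<omega> $ i)) 0"
    using I[of 1] E by (simp add: has_bochner_integral_iff)
  \<comment> \<open>Since the mean is zero, the second moment is the variance, the square of
    \<open>?s\<close>.\<close>
  show "has_bochner_integral M (\<lambda>\<omega>. (p (n \<omega> $ i))\<^sup>2) (var / 2)"
    using I[of 2] normal_distributed_variance[OF s D] E \<open>var > 0\<close>
    by (simp add: has_bochner_integral_iff)
qed

text \<open>Expansion in the real basis \<open>axis i 1\<close>, \<open>axis i \<i>\<close>: it
  reduces a vector-valued integral to the integrals of real and imaginary parts.\<close>

lemma complex_cart_eq_sum_axis:
  "(z :: complex ^ 'd) = (\<Sum>i\<in>UNIV. Re (z $ i) *\<^sub>R axis i 1 + Im (z $ i) *\<^sub>R axis i \<i>)"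
proof -
  have "(\<Sum>i\<in>UNIV. Re (z $ i) *\<^sub>R axis i 1 + Im (z $ i) *\<^sub>R axis i \<i>) $ j
      = (\<Sum>i\<in>UNIV. if j = i then z $ i else 0)" for j
    unfolding sum_component
    by (intro sum.cong) (auto simp: axis_def complex_eq_iff)
  then show ?thesis by (simp add: vec_eq_iff)
qed

lemma white_complex_gaussian_mean:
  fixes n :: "'w \<Rightarrow> complex ^ 'd"
  assumes "prob_space M" and "white_complex_gaussian M var n" and "var > 0"
  shows "has_bochner_integral M n 0"
proof -
  \<comment> \<open>The zero limit is written in the shape of the integrand, so that the rules for
    sums and scaling apply term by term.\<close>
  have "has_bochner_integral M
      (\<lambda>\<omega>. \<Sum>i\<in>UNIV. Re (n \<omega> $ i) *\<^sub>R axis i 1 + Im (n \<omega> $ i) *\<^sub>R axis i \<i>)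
      (\<Sum>i\<in>UNIV. 0 *\<^sub>R axis i 1 + 0 *\<^sub>R axis i \<i>)"
    by (intro has_bochner_integral_sum has_bochner_integral_add has_bochner_integral_scaleR_left
        white_complex_gaussian_part[OF assms]) auto
  then show ?thesis
    by (simp flip: complex_cart_eq_sum_axis)
qed

lemma white_complex_gaussian_norm_sq:
  fixes n :: "'w \<Rightarrow> complex ^ 'd"
  assumes "prob_space M" and "white_complex_gaussian M var n" and "var > 0"
  shows "(LINT \<omega>|M. (norm (n \<omega>))\<^sup>2) = real CARD('d) * var"
proof -
  have "has_bochner_integral M
      (\<lambda>\<omega>. \<Sum>i\<in>UNIV. (Re (n \<omega> $ i))\<^sup>2 + (Im (n \<omega> $ i))\<^sup>2) (\<Sum>i\<in>(UNIV :: 'd set). var / 2 + var / 2)"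
    by (intro has_bochner_integral_sum has_bochner_integral_add
        white_complex_gaussian_part[OF assms]) auto
  moreover have "(norm z)\<^sup>2 = (\<Sum>i\<in>UNIV. (Re (z $ i))\<^sup>2 + (Im (z $ i))\<^sup>2)" for z :: "complex ^ 'd"
    by (simp add: norm_vec_def L2_set_def sum_nonneg cmod_power2)
  ultimately show ?thesis
    by (simp add: has_bochner_integral_iff)
qed

text \<open>The estimator is affine in the noise, whose mean is zero, so only the deterministic part
  survives.\<close>

lemma gradient_estimator_mean:
  fixes n :: "'w \<Rightarrow> complex ^ 'd"
  assumes "prob_space M" and "has_bochner_integral M n 0"
  shows "has_bochner_integral M (\<lambda>\<omega>. gradient_estimator S h v b c g (n \<omega>))
    (\<Sum>k\<in>S. (h k * b k / complex_of_real c) *s complex_vec (g k))"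
proof -
  interpret prob_space M by fact
  have "has_bochner_integral M (\<lambda>\<omega>. A + r *\<^sub>R n \<omega>) (A + r *\<^sub>R 0)" for A r
    by (intro has_bochner_integral_add has_bochner_integral_scaleR_right assms(2))
      (simp add: has_bochner_integral_iff prob_space)
  then show ?thesis unfolding gradient_estimator_def by simp
qed

lemma complex_vec_global_gradient:
  "complex_vec (global_gradient S lam g) = (\<Sum>k\<in>S. complex_of_real (lam k) *s complex_vec (g k))"
  by (simp add: complex_vec_def global_gradient_def vec_eq_iff)

text \<open>By the mean formula, unbiasedness says that two linear expressions in the local
  gradients agree for all gradients. Comparing coefficients and solving for \<open>b k\<close> gives
  channel inversion.\<close>

lemma unbiased_design_iff:
  fixes n :: "'w \<Rightarrow> complex ^ 'd"
  assumes "prob_space M" and "has_bochner_integral M n 0"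
    and "finite S" and "\<And>k. k \<in> S \<Longrightarrow> h k \<noteq> 0" and "c > 0"
  shows "unbiased_design M n S h lam v b c \<longleftrightarrow> (\<forall>k\<in>S. b k = complex_of_real (lam k * c) / h k)"
proof -
  note mean = gradient_estimator_mean[OF assms(1,2), of S h v b c, unfolded has_bochner_integral_iff]
  have "unbiased_design M n S h lam v b c \<longleftrightarrow>
    (\<forall>g :: nat \<Rightarrow> real ^ 'd. (\<Sum>k\<in>S. (h k * b k / complex_of_real c) *s complex_vec (g k))
        = (\<Sum>k\<in>S. complex_of_real (lam k) *s complex_vec (g k)))"
    unfolding unbiased_design_def complex_vec_global_gradient using mean by simp
  also have "\<dots> \<longleftrightarrow> (\<forall>k\<in>S. h k * b k / complex_of_real c = complex_of_real (lam k))"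
  proof (intro iffI ballI allI)
    fix j
    assume *: "\<forall>g :: nat \<Rightarrow> real ^ 'd. (\<Sum>k\<in>S. (h k * b k / complex_of_real c) *s complex_vec (g k))
        = (\<Sum>k\<in>S. complex_of_real (lam k) *s complex_vec (g k))" and j: "j \<in> S"
    \<comment> \<open>Test gradients: all ones for client \<open>j\<close>, zero for the others.
      Every coordinate of the sum then isolates the coefficient of \<open>j\<close>.\<close>
    let ?g = "\<lambda>k. (\<chi> i. if k = j then 1 else 0) :: real ^ 'd"
    have coeff: "(\<Sum>k\<in>S. a k *s complex_vec (?g k)) $ i = a j" for a i
    proof -
      have "(\<Sum>k\<in>S. a k *s complex_vec (?g k)) $ i = (\<Sum>k\<in>S. if k = j then a k else 0)"
        unfolding sum_component by (intro sum.cong) (auto simp: complex_vec_def)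
      then show ?thesis using j \<open>finite S\<close> by simp
    qed
    \<comment> \<open>Any coordinate yields the equation; \<open>undefined\<close> merely names
      one.\<close>
    show "h j * b j / complex_of_real c = complex_of_real (lam j)"
      using arg_cong[OF *[rule_format, of ?g], of "\<lambda>z. z $ undefined"] unfolding coeff .
  qed (auto intro: sum.cong)
  also have "\<dots> \<longleftrightarrow> (\<forall>k\<in>S. b k = complex_of_real (lam k * c) / h k)"
    using assms(4,5) by (intro ball_cong) (auto simp: field_simps)
  finally show ?thesis .
qed

text \<open>Channel inversion cancels the signal against the target for every \<open>g\<close>,
  leaving the noise scaled by \<open>sqrt v / c\<close>. The value therefore depends on the design
  only through \<open>c\<close>.\<close>

lemma estimation_variance_unbiased:
  fixes n :: "'w \<Rightarrow> complex ^ 'd"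
  assumes "prob_space M" and "white_complex_gaussian M var n" and "var > 0" and "v > 0"
    and "\<And>k. k \<in> S \<Longrightarrow> h k \<noteq> 0" and "c > 0"
    and b: "\<forall>k\<in>S. b k = complex_of_real (lam k * c) / h k"
  shows "estimation_variance M n S h lam v g b c = real CARD('d) * v * var / c\<^sup>2"
proof -
  have "(\<Sum>k\<in>S. (h k * b k / complex_of_real c) *s complex_vec (g k))
      = complex_vec (global_gradient S lam g)"
    unfolding complex_vec_global_gradient using assms(5,6) b by (intro sum.cong) auto
  then have "estimation_variance M n S h lam v g b c
      = (LINT \<omega>|M. (v / c\<^sup>2) * (norm (n \<omega>))\<^sup>2)"
    using \<open>v > 0\<close>
    by (simp add: estimation_variance_def gradient_estimator_def power_mult_distrib power_divide)
  then show ?thesis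
    by (simp add: white_complex_gaussian_norm_sq[OF assms(1-3)])
qed

text \<open>Once unbiasedness fixes \<open>b\<close> on \<open>S\<close>, \<open>cmod (b k)\<close>
  is \<open>lam k * c / cmod (h k)\<close>, so each power constraint bounds \<open>c\<close> from
  above. The design problem becomes one in the single variable \<open>c\<close>.\<close>

lemma feasible_design_iff:
  fixes n :: "'w \<Rightarrow> complex ^ 'd"
  assumes "prob_space M" and "has_bochner_integral M n 0"
    and "finite S" and "S \<noteq> {}" and "P0 > 0"
    and h: "\<And>k. k \<in> S \<Longrightarrow> h k \<noteq> 0" and lam: "\<And>k. k \<in> S \<Longrightarrow> lam k > 0"
  shows "feasible_design M n S h lam v P0 b c \<longleftrightarrow>
    0 < c \<and> c \<le> Min ((\<lambda>k. sqrt P0 * cmod (h k) / lam k) ` S) \<and>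
    (\<forall>k\<in>S. b k = complex_of_real (lam k * c) / h k)"
proof -
  have "(cmod (b k))\<^sup>2 \<le> P0 \<longleftrightarrow> c \<le> sqrt P0 * cmod (h k) / lam k"
    if "k \<in> S" "c > 0" "b k = complex_of_real (lam k * c) / h k" for k
  proof -
    have "(cmod (b k))\<^sup>2 \<le> P0 \<longleftrightarrow> cmod (b k) \<le> sqrt P0"
      using \<open>P0 > 0\<close> by (metis norm_ge_zero real_le_rsqrt real_sqrt_le_iff real_sqrt_unique)
    also have "\<dots> \<longleftrightarrow> lam k * c / cmod (h k) \<le> sqrt P0"
      using that lam[OF that(1)] by (simp add: norm_divide norm_mult)
    also have "\<dots> \<longleftrightarrow> c \<le> sqrt P0 * cmod (h k) / lam k"
      using h[OF that(1)] lam[OF that(1)] by (simp add: field_simps)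
    finally show ?thesis .
  qed
  then show ?thesis
    using unbiased_design_iff[OF assms(1-3) h] assms(3,4)
    unfolding feasible_design_def by (auto simp: Min_ge_iff)
qed

theorem lemma2:
  fixes M :: "'w measure"
    and n :: "'w \<Rightarrow> complex ^ 'd"
    and S :: "nat set" and K :: nat
    and h :: "nat \<Rightarrow> complex" and lam :: "nat \<Rightarrow> real"
    and P0 \<sigma> v :: real
    and g :: "nat \<Rightarrow> real ^ 'd"
  assumes "S \<subseteq> {1..K}" and "S \<noteq> {}"
    and "P0 > 0" and "\<sigma> > 0" and "v > 0"
    and "\<And>k. k \<in> S \<Longrightarrow> h k \<noteq> 0"
    and "\<And>k. k \<in> S \<Longrightarrow> lam k > 0"
    and "prob_space M"
    and "white_complex_gaussian M (\<sigma>\<^sup>2) n"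
  shows "(\<forall>b c. is_arg_min (\<lambda>(b, c). estimation_variance M n S h lam v g b c)
                  (\<lambda>(b, c). feasible_design M n S h lam v P0 b c) (b, c) \<longleftrightarrow>
                (\<forall>k\<in>S. b k = complex_of_real (lam k * c) / h k) \<and>
                c = Min ((\<lambda>k. sqrt P0 * cmod (h k) / lam k) ` S)) \<and>
         (\<forall>b c. is_arg_min (\<lambda>(b, c). estimation_variance M n S h lam v g b c)
                  (\<lambda>(b, c). feasible_design M n S h lam v P0 b c) (b, c) \<longrightarrow>
                estimation_variance M n S h lam v g b c =
                real CARD('d) * v * \<sigma>\<^sup>2 / P0 * Max ((\<lambda>k. (lam k)\<^sup>2 / (cmod (h k))\<^sup>2) ` S))"
proof -
  let ?c = "Min ((\<lambda>k. sqrt P0 * cmod (h k) / lam k) ` S)"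
  let ?E = "\<lambda>(b, c). estimation_variance M n S h lam v g b c"
  let ?F = "\<lambda>(b, c). feasible_design M n S h lam v P0 b c"
  let ?B = "\<lambda>b c. \<forall>k\<in>S. b k = complex_of_real (lam k * c) / h k"
  have fin: "finite S" using assms(1) finite_subset by blast
  have var: "\<sigma>\<^sup>2 > 0" using assms(4) by simp
  have F: "?F (b, c) \<longleftrightarrow> 0 < c \<and> c \<le> ?c \<and> ?B b c" for b c
    using feasible_design_iff[OF assms(8) white_complex_gaussian_mean[OF assms(8,9) var]
      fin assms(2,3,6,7)] by simp
  have E: "?E (b, c) = real CARD('d) * v * \<sigma>\<^sup>2 / c\<^sup>2" if "0 < c" "?B b c" for b c
    using estimation_variance_unbiased[OF assms(8,9) var assms(5,6) that] by simp
  have C: "real CARD('d) * v * \<sigma>\<^sup>2 > 0" using assms(5) var by simp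
  \<comment> \<open>A client \<open>k0\<close> attaining the minimum shows that \<open>?c\<close> is
    positive and later serves as the witness for the maximum.\<close>
  have "?c \<in> (\<lambda>k. sqrt P0 * cmod (h k) / lam k) ` S"
    using fin assms(2) by (intro Min_in) auto
  then obtain k0 where k0: "k0 \<in> S" and c_k0: "?c = sqrt P0 * cmod (h k0) / lam k0"
    by auto
  have c_pos: "?c > 0"
    unfolding c_k0 using assms(3) assms(6)[OF k0] assms(7)[OF k0] by simp
  \<comment> \<open>The map from \<open>x\<close> to \<open>P0 / x\<^sup>2\<close> decreases on
    positive reals and sends each client's bound on \<open>c\<close> to its ratio, so it turns the
    minimum into the maximum.\<close>
  have Max: "Max ((\<lambda>k. (lam k)\<^sup>2 / (cmod (h k))\<^sup>2) ` S) = P0 / ?c\<^sup>2"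
  proof (rule Max_eqI)
    have ratio: "P0 / (sqrt P0 * cmod (h k) / lam k)\<^sup>2 = (lam k)\<^sup>2 / (cmod (h k))\<^sup>2" for k
      using assms(3) by (simp add: power_divide power_mult_distrib)
    show "P0 / ?c\<^sup>2 \<in> (\<lambda>k. (lam k)\<^sup>2 / (cmod (h k))\<^sup>2) ` S"
      unfolding c_k0 ratio using k0 by blast
    fix y assume "y \<in> (\<lambda>k. (lam k)\<^sup>2 / (cmod (h k))\<^sup>2) ` S"
    then obtain k where k: "k \<in> S" "y = (lam k)\<^sup>2 / (cmod (h k))\<^sup>2" by blast
    have "?c \<le> sqrt P0 * cmod (h k) / lam k" using k(1) fin by simp
    then have "?c\<^sup>2 \<le> (sqrt P0 * cmod (h k) / lam k)\<^sup>2"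
      using c_pos by (intro power_mono) auto
    then show "y \<le> P0 / ?c\<^sup>2"
      unfolding k(2) ratio[symmetric] using assms(3) c_pos by (intro frac_le) auto
  qed (use fin in simp)
  \<comment> \<open>Values of \<open>b\<close> outside \<open>S\<close> are free, so minimizers are
    characterized by \<open>?B\<close> rather than by an equation between functions.\<close>
  have opt: "is_arg_min ?E ?F (b, c) \<longleftrightarrow> ?B b c \<and> c = ?c" for b c
  proof
    assume arg: "is_arg_min ?E ?F (b, c)"
    then have bc: "0 < c" "c \<le> ?c" "?B b c"
      using F[of b c] unfolding is_arg_min_def by blast+
    \<comment> \<open>The competitor is channel inversion at the largest admissible
      \<open>c\<close>. It is feasible, and it would be strictly better if
      \<open>c < ?c\<close>.\<close>
    let ?b = "\<lambda>k. complex_of_real (lam k * ?c) / h k"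
    have "\<not> ?E (?b, ?c) < ?E (b, c)"
      using arg F[of ?b ?c] c_pos unfolding is_arg_min_def by blast
    moreover have "?E (?b, ?c) = real CARD('d) * v * \<sigma>\<^sup>2 / ?c\<^sup>2"
      using c_pos by (intro E) auto
    ultimately have "\<not> real CARD('d) * v * \<sigma>\<^sup>2 / ?c\<^sup>2 < real CARD('d) * v * \<sigma>\<^sup>2 / c\<^sup>2"
      using E[OF bc(1,3)] by simp
    moreover have "real CARD('d) * v * \<sigma>\<^sup>2 / ?c\<^sup>2 < real CARD('d) * v * \<sigma>\<^sup>2 / c\<^sup>2" if "c < ?c"
      using that bc(1) C by (intro divide_strict_left_mono power_strict_mono) auto
    ultimately show "?B b c \<and> c = ?c" using bc by fastforce
  next
    assume bc: "?B b c \<and> c = ?c"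
    have "\<not> ?E (b', c') < ?E (b, c)" if "?F (b', c')" for b' c'
    proof -
      have *: "0 < c'" "c' \<le> ?c" "?B b' c'" using that F by blast+
      \<comment> \<open>Conversely, every feasible \<open>c'\<close> is at most \<open>?c\<close>,
        so its variance is at least the one at \<open>?c\<close>.\<close>
      have "real CARD('d) * v * \<sigma>\<^sup>2 / ?c\<^sup>2 \<le> real CARD('d) * v * \<sigma>\<^sup>2 / c'\<^sup>2"
        using *(1,2) c_pos C by (intro divide_left_mono power_mono) auto
      then show ?thesis using E[OF *(1,3)] E[of c b] bc c_pos by simp
    qed
    then show "is_arg_min ?E ?F (b, c)"
      using F[of b c] bc c_pos unfolding is_arg_min_def by auto
  qed
  moreover have "?E (b, c) = real CARD('d) * v * \<sigma>\<^sup>2 / P0 *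
      Max ((\<lambda>k. (lam k)\<^sup>2 / (cmod (h k))\<^sup>2) ` S)" if "is_arg_min ?E ?F (b, c)" for b c
    unfolding Max using that[unfolded opt] E[of c b] c_pos assms(3) by simp
  ultimately show ?thesis by simp
qed

end
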